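(* Let $M(s)$ and $N(s)$ be real rational matrix functions of sizes $q\times k$ and $q\times m$ such that the system $M(s)\hat y=N(s)\hat u+\hat w$ (from $w,u$ to $y$) is causal and well-posed. Assume that $M(j\omega)$ has full column rank for all $\omega\in\mathbb{R}$ and that $M(j\omega)M(j\omega)^*+N(j\omega)N(j\omega)^*$ is invertible for all $\omega\in\mathbb{R}$. Let $\omega_0\in\mathbb{R}$ be such that the constant matrix $$K := -N(j\omega_0)^*M(j\omega_0)\left(M(j\omega_0)^*M(j\omega_0)\right)^{-1}$$ is real-valued. If $(M-NK)^{-1}\in RH_\infty$ and $$\omega_0\in\arg\max_{\omega\in\mathbb{R}}\left\|\begin{bmatrix} I\\ K\end{bmatrix}\left(M(j\omega)-N(j\omega)K\right)^{-1}\right\|,$$ then $K$ solves the $H_\infty$ optimal control problem $$\inf_{\tilde K\in RL_\infty}\left\|\begin{bmatrix} I\\ \tilde K\end{bmatrix}(M-N\tilde K)^{-1}\right\|_\infty .$$ Moreover, in this case the optimal value of the problem is $$\left\|\left(M(j\omega_0)M(j\omega_0)^*+N(j\omega_0)N(j\omega_0)^*\right)^{-1}\right\|^{1/2}.$$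
   Context: Here $j$ is the imaginary unit, $\|\cdot\|$ applied to a complex matrix is the spectral norm, and $^*$ is the conjugate transpose. $RH_\infty$ is the set of proper real rational stable transfer matrices (all poles in the open left half plane), with norm $\|F\|_\infty=\sup_{\mathrm{Re}(s)>0}\|F(s)\|=\sup_{\omega\in\mathbb{R}}\|F(j\omega)\|$. $RL_\infty$ is the set of proper real rational matrix functions with no poles on the imaginary axis; controllers $\tilde K\in RL_\infty$ have size $m\times k$. The assumptions on $M(j\omega)$, $N(j\omega)$ presuppose that these matrices are finite for all real $\omega$. When $M$ is square and invertible, realizability of the system means that $M^{-1}$ and $M^{-1}N$ are proper. The problem is to find a stabilizing controller $\hat u=\tilde K\hat y$ minimizing the $H_\infty$ norm of the closed-loop map from $w$ to $(y,u)$. The infimum is over $\tilde K\in RL_\infty$ that are stabilizing, i.e. $M-N\tilde K$ is invertible as a (square) rational matrix with $(M-N\tilde K)^{-1}\in RH_\infty$; the value is $\infty$ if there is no such $\tilde K$. A matrix "solves" the problem if it is feasible (stabilizing) and attains the infimum. *)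

theory Defs
  imports "HOL-Analysis.Analysis" "HOL-Computational_Algebra.Field_as_Ring"
    "HOL-Computational_Algebra.Polynomial_Factorial"
    "HOL-Computational_Algebra.Normalized_Fraction"
begin

type_synonym ratfun = "real poly fract"

(* quot_of_fract yields the fraction in lowest terms, so poles are exactly the
   complex zeros of the denominator. *)

definition rat_pole :: "ratfun \<Rightarrow> complex \<Rightarrow> bool" where
  "rat_pole f s \<longleftrightarrow> poly (map_poly of_real (snd (quot_of_fract f))) s = 0"

(* At a pole the value is 0, by the convention x / 0 = 0. *)
definition rat_eval :: "ratfun \<Rightarrow> complex \<Rightarrow> complex" where
  "rat_eval f s =
     poly (map_poly of_real (fst (quot_of_fract f))) s /
     poly (map_poly of_real (snd (quot_of_fract f))) s"

definition rat_proper :: "ratfun \<Rightarrow> bool" where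
  "rat_proper f \<longleftrightarrow> degree (fst (quot_of_fract f)) \<le> degree (snd (quot_of_fract f))"

definition mat_pole :: "ratfun^'n^'m \<Rightarrow> complex \<Rightarrow> bool" where
  "mat_pole F s \<longleftrightarrow> (\<exists>i j. rat_pole (F $ i $ j) s)"

definition mat_eval :: "ratfun^'n^'m \<Rightarrow> complex \<Rightarrow> complex^'n^'m" where
  "mat_eval F s = (\<chi> i j. rat_eval (F $ i $ j) s)"

definition mat_proper :: "ratfun^'n^'m \<Rightarrow> bool" where
  "mat_proper F \<longleftrightarrow> (\<forall>i j. rat_proper (F $ i $ j))"

definition RH_inf :: "(ratfun^'n^'m) set" where
  "RH_inf = {F. mat_proper F \<and> (\<forall>s. mat_pole F s \<longrightarrow> Re s < 0)}"

definition RL_inf :: "(ratfun^'n^'m) set" where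
  "RL_inf = {F. mat_proper F \<and> (\<forall>s. mat_pole F s \<longrightarrow> Re s \<noteq> 0)}"

definition const_rat :: "real^'n^'m \<Rightarrow> ratfun^'n^'m" where
  "const_rat A = (\<chi> i j. Fract [:A $ i $ j:] 1)"

definition cmat :: "real^'n^'m \<Rightarrow> complex^'n^'m" where
  "cmat A = (\<chi> i j. complex_of_real (A $ i $ j))"

definition conj_transpose :: "complex^'n^'m \<Rightarrow> complex^'m^'n" where
  "conj_transpose A = (\<chi> i j. cnj (A $ j $ i))"

(* The norm on complex^'n is the Euclidean one. *)
definition spectral_norm :: "complex^'n^'m \<Rightarrow> real" where
  "spectral_norm A = onorm ((*v) A)"

definition vstack :: "'a^'n^'k \<Rightarrow> 'a^'n^'m \<Rightarrow> 'a^'n^('k + 'm)" where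
  "vstack A B = (\<chi> i. case i of Inl a \<Rightarrow> A $ a | Inr b \<Rightarrow> B $ b)"

(* A pole in the open right half plane makes the supremum infinite, whatever value
   is assigned at the pole itself, because F is unbounded in its neighbourhood. *)
definition Hinf_norm :: "ratfun^'n^'m \<Rightarrow> ereal" where
  "Hinf_norm F = (SUP s \<in> {s. Re s > 0}. ereal (spectral_norm (mat_eval F s)))"

(* The system M y = N u + w, from (w, u) to y. Over a field, invertible includes
   squareness, i.e. CARD('q) = CARD('k). *)
definition causal_well_posed :: "ratfun^'k^'q \<Rightarrow> ratfun^'m^'q \<Rightarrow> bool" where
  "causal_well_posed M N \<longleftrightarrow>
     invertible M \<and> mat_proper (matrix_inv M) \<and> mat_proper (matrix_inv M ** N)"

definition stabilizing :: "ratfun^'k^'q \<Rightarrow> ratfun^'m^'q \<Rightarrow> (ratfun^'k^'m) set" where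
  "stabilizing M N =
     {K \<in> RL_inf. invertible (M - N ** K) \<and> matrix_inv (M - N ** K) \<in> RH_inf}"

definition closed_loop ::
    "ratfun^'k^'q \<Rightarrow> ratfun^'m^'q \<Rightarrow> ratfun^'k^'m \<Rightarrow> ratfun^'q^('k + 'm)" where
  "closed_loop M N K = vstack (mat 1) K ** matrix_inv (M - N ** K)"

(* The infimum of the empty set of extended reals is \<infinity>. *)
definition optimal_value :: "ratfun^'k^'q \<Rightarrow> ratfun^'m^'q \<Rightarrow> ereal" where
  "optimal_value M N = (INF K \<in> stabilizing M N. Hinf_norm (closed_loop M N K))"

definition solves_Hinf ::
    "ratfun^'k^'q \<Rightarrow> ratfun^'m^'q \<Rightarrow> ratfun^'k^'m \<Rightarrow> bool" where
  "solves_Hinf M N K \<longleftrightarrow>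
     K \<in> stabilizing M N \<and> Hinf_norm (closed_loop M N K) = optimal_value M N"

end

theory Submission
  imports Defs "HOL-Complex_Analysis.Conformal_Mappings"
begin

text \<open>
  Write \<open>M\<^sub>0\<close>, \<open>N\<^sub>0\<close> for the values of \<open>M\<close>, \<open>N\<close> at the frequency \<open>\<omega>\<^sub>0\<close>, and let
  \<open>P = M\<^sub>0 M\<^sub>0\<^sup>* + N\<^sub>0 N\<^sub>0\<^sup>*\<close>. The closed-loop map \<open>X\<close> of a stabilizing controller satisfies
  \<open>[M, -N] X = I\<close>, so its value at \<open>\<i>\<omega>\<^sub>0\<close> is a right inverse of the fixed matrix
  \<open>[M\<^sub>0, -N\<^sub>0]\<close>. Every right inverse has spectral norm at least \<open>\<parallel>P\<^sup>-\<^sup>1\<parallel>\<^sup>1\<^sup>/\<^sup>2\<close>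
  (\<open>right_inverse_norm_bound\<close>), and the norm at a point of the imaginary axis that is not a pole
  is a limit of norms in the open right half plane, hence bounded by the \<open>H\<^sub>\<infinity>\<close> norm
  (\<open>spectral_norm_imag_axis_le_Hinf_norm\<close>). This bounds the optimal value from below by a
  quantity that depends on a single frequency (\<open>optimal_value_ge\<close>).

  The Moore--Penrose inverse \<open>[M\<^sub>0, -N\<^sub>0]\<^sup>* P\<^sup>-\<^sup>1\<close> attains this minimum
  (\<open>pseudo_inverse_norm\<close>), and the gain \<open>K\<close> of the theorem is precisely the one whose closed-loop
  map has this value at \<open>\<omega>\<^sub>0\<close> (\<open>least_squares_gain_inverse\<close>). Since \<open>\<omega>\<^sub>0\<close> is the worst
  frequency for \<open>K\<close>, the closed-loop map of \<open>K\<close> is bounded by \<open>\<parallel>P\<^sup>-\<^sup>1\<parallel>\<^sup>1\<^sup>/\<^sup>2\<close> on the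
  whole imaginary axis. It is proper and stable, so the maximum principle carries the bound over
  to the right half plane (\<open>spectral_norm_half_plane_le\<close>), and the two bounds meet.
\<close>

section \<open>Values of rational functions and rational matrices\<close>

abbreviation cpoly :: "real poly \<Rightarrow> complex \<Rightarrow> complex" where
  "cpoly p s \<equiv> poly (map_poly of_real p) s"

lemma cpoly_add: "cpoly (p + q) s = cpoly p s + cpoly q s"
proof -
  have "map_poly (of_real :: real \<Rightarrow> complex) (p + q) = map_poly of_real p + map_poly of_real q"
    by (intro poly_eqI) (simp add: coeff_map_poly)
  then show ?thesis by simp
qed

lemma cpoly_diff: "cpoly (p - q) s = cpoly p s - cpoly q s"
  using cpoly_add[of "p - q" q s] by simp

lemma cpoly_mult: "cpoly (p * q) s = cpoly p s * cpoly q s"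
proof (induction p)
  case 0
  then show ?case by simp
next
  case (pCons a p)
  have "map_poly (of_real :: real \<Rightarrow> complex) (smult a q) = smult (of_real a) (map_poly of_real q)"
    by (intro poly_eqI) (simp add: coeff_map_poly)
  then show ?case
    using pCons by (simp add: cpoly_add map_poly_pCons algebra_simps)
qed

lemma degree_cpoly: "degree (map_poly (of_real :: real \<Rightarrow> complex) p) = degree p"
  by (rule degree_map_poly) simp

text \<open>
  Poles and values may be read off from any representation whose denominator does not vanish at
  the point: the denominator in lowest terms divides the given one. This is what makes evaluation
  multiplicative and additive away from the poles.
\<close>

lemma rat_Fract:
  assumes "cpoly q s \<noteq> 0"
  shows "\<not> rat_pole (Fract p q) s" and "rat_eval (Fract p q) s = cpoly p s / cpoly q s"
proof -
  define a b where "a = fst (quot_of_fract (Fract p q))" and "b = snd (quot_of_fract (Fract p q))"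
  have q: "q \<noteq> 0" using assms by auto
  have b: "b \<noteq> 0" by (simp add: b_def)
  have "Fract a b = Fract p q" by (simp add: a_def b_def)
  then have eq: "a * q = p * b" using q b by (simp add: eq_fract)
  have "coprime b a" using coprime_quot_of_fract[of "Fract p q"]
    by (simp add: a_def b_def coprime_commute)
  moreover have "b dvd a * q" by (simp add: eq)
  ultimately have "b dvd q" by (simp add: coprime_dvd_mult_right_iff)
  then have nz: "cpoly b s \<noteq> 0"
    using assms by (auto simp: dvd_def cpoly_mult)
  then show "\<not> rat_pole (Fract p q) s" by (simp add: rat_pole_def b_def)
  have "cpoly a s * cpoly q s = cpoly p s * cpoly b s"
    by (simp add: eq flip: cpoly_mult)
  then show "rat_eval (Fract p q) s = cpoly p s / cpoly q s"
    using nz assms by (simp add: rat_eval_def field_simps flip: a_def b_def)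
qed

lemma not_rat_pole_E:
  assumes "\<not> rat_pole f s"
  obtains p q where "f = Fract p q" "cpoly q s \<noteq> 0" "q \<noteq> 0"
    "rat_eval f s = cpoly p s / cpoly q s"
  using assms that[of "fst (quot_of_fract f)" "snd (quot_of_fract f)"]
  by (auto simp: rat_pole_def rat_eval_def)

lemma rat_eval_add:
  assumes "\<not> rat_pole f s" "\<not> rat_pole g s"
  shows "\<not> rat_pole (f + g) s" "rat_eval (f + g) s = rat_eval f s + rat_eval g s"
proof -
  obtain p q where f: "f = Fract p q" "cpoly q s \<noteq> 0" "q \<noteq> 0" "rat_eval f s = cpoly p s / cpoly q s"
    using assms(1) by (rule not_rat_pole_E)
  obtain p' q' where g: "g = Fract p' q'" "cpoly q' s \<noteq> 0" "q' \<noteq> 0"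
      "rat_eval g s = cpoly p' s / cpoly q' s"
    using assms(2) by (rule not_rat_pole_E)
  have *: "f + g = Fract (p * q' + p' * q) (q * q')" using f g by simp
  have nz: "cpoly (q * q') s \<noteq> 0" using f g by (simp add: cpoly_mult)
  show "\<not> rat_pole (f + g) s" unfolding * by (rule rat_Fract(1)[OF nz])
  show "rat_eval (f + g) s = rat_eval f s + rat_eval g s"
    unfolding * rat_Fract(2)[OF nz] f(4) g(4)
    by (simp only: cpoly_add cpoly_mult add_frac_eq[OF f(2) g(2)])
qed

lemma rat_eval_mult:
  assumes "\<not> rat_pole f s" "\<not> rat_pole g s"
  shows "\<not> rat_pole (f * g) s" "rat_eval (f * g) s = rat_eval f s * rat_eval g s"
proof -
  obtain p q where f: "f = Fract p q" "cpoly q s \<noteq> 0" "q \<noteq> 0" "rat_eval f s = cpoly p s / cpoly q s"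
    using assms(1) by (rule not_rat_pole_E)
  obtain p' q' where g: "g = Fract p' q'" "cpoly q' s \<noteq> 0" "q' \<noteq> 0"
      "rat_eval g s = cpoly p' s / cpoly q' s"
    using assms(2) by (rule not_rat_pole_E)
  have *: "f * g = Fract (p * p') (q * q')" using f g by simp
  have nz: "cpoly (q * q') s \<noteq> 0" using f g by (simp add: cpoly_mult)
  show "\<not> rat_pole (f * g) s" unfolding * by (rule rat_Fract(1)[OF nz])
  show "rat_eval (f * g) s = rat_eval f s * rat_eval g s"
    unfolding * rat_Fract(2)[OF nz] f(4) g(4) by (simp add: cpoly_mult)
qed

lemma rat_eval_const:
  "\<not> rat_pole (Fract [:c:] 1) s" "rat_eval (Fract [:c:] 1) s = of_real c"
  using rat_Fract[of 1 s "[:c:]"] by (simp_all add: map_poly_pCons)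

lemma rat_eval_0: "\<not> rat_pole 0 s" "rat_eval 0 s = 0"
  and rat_eval_1: "\<not> rat_pole 1 s" "rat_eval 1 s = 1"
  by (simp_all add: rat_pole_def rat_eval_def)

lemma rat_eval_diff:
  assumes "\<not> rat_pole f s" "\<not> rat_pole g s"
  shows "\<not> rat_pole (f - g) s" "rat_eval (f - g) s = rat_eval f s - rat_eval g s"
proof -
  obtain p q where f: "f = Fract p q" "cpoly q s \<noteq> 0" "q \<noteq> 0" "rat_eval f s = cpoly p s / cpoly q s"
    using assms(1) by (rule not_rat_pole_E)
  obtain p' q' where g: "g = Fract p' q'" "cpoly q' s \<noteq> 0" "q' \<noteq> 0"
      "rat_eval g s = cpoly p' s / cpoly q' s"
    using assms(2) by (rule not_rat_pole_E)
  have *: "f - g = Fract (p * q' - p' * q) (q * q')" using f g by simp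
  have nz: "cpoly (q * q') s \<noteq> 0" using f g by (simp add: cpoly_mult)
  show "\<not> rat_pole (f - g) s" unfolding * by (rule rat_Fract(1)[OF nz])
  show "rat_eval (f - g) s = rat_eval f s - rat_eval g s"
    unfolding * rat_Fract(2)[OF nz] f(4) g(4)
    by (simp only: cpoly_diff cpoly_mult diff_frac_eq[OF f(2) g(2)])
qed

lemma rat_eval_sum:
  assumes "\<And>i. i \<in> I \<Longrightarrow> \<not> rat_pole (f i) s"
  shows "\<not> rat_pole (sum f I) s \<and> rat_eval (sum f I) s = (\<Sum>i\<in>I. rat_eval (f i) s)"
  using assms
  by (induction I rule: infinite_finite_induct) (auto simp: rat_eval_0 rat_eval_add)

lemma mat_eval_mult:
  assumes "\<not> mat_pole A s" "\<not> mat_pole B s"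
  shows "\<not> mat_pole (A ** B) s" "mat_eval (A ** B) s = mat_eval A s ** mat_eval B s"
proof -
  have "\<not> rat_pole ((A ** B) $ i $ j) s \<and>
      rat_eval ((A ** B) $ i $ j) s = (mat_eval A s ** mat_eval B s) $ i $ j" for i j
    using rat_eval_sum[of UNIV "\<lambda>k. A $ i $ k * B $ k $ j" s] assms
    by (simp add: matrix_matrix_mult_def mat_eval_def mat_pole_def rat_eval_mult)
  then show "\<not> mat_pole (A ** B) s" "mat_eval (A ** B) s = mat_eval A s ** mat_eval B s"
    by (simp_all add: mat_pole_def vec_eq_iff) (simp add: mat_eval_def)
qed

lemma mat_eval_diff:
  assumes "\<not> mat_pole A s" "\<not> mat_pole B s"
  shows "\<not> mat_pole (A - B) s" "mat_eval (A - B) s = mat_eval A s - mat_eval B s"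
  using assms by (simp_all add: mat_pole_def mat_eval_def vec_eq_iff rat_eval_diff)

lemma mat_eval_const_rat: "\<not> mat_pole (const_rat A) s" "mat_eval (const_rat A) s = cmat A"
  by (simp_all add: mat_pole_def mat_eval_def const_rat_def cmat_def vec_eq_iff rat_eval_const)

lemma const_rat_in_RL_inf: "const_rat A \<in> RL_inf"
proof -
  have "rat_proper (Fract [:c:] 1)" for c :: real
  proof -
    have "snd (quot_of_fract (Fract [:c:] 1)) = 1"
      by (rule snd_quot_of_fract_Fract_whole) simp
    then have "Fract (fst (quot_of_fract (Fract [:c:] 1))) 1 = Fract [:c:] 1"
      by (metis Fract_quot_of_fract)
    then have "fst (quot_of_fract (Fract [:c:] 1)) = [:c:]"
      by (simp add: eq_fract)
    then show ?thesis by (simp add: rat_proper_def)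
  qed
  then have "mat_proper (const_rat A)" by (simp add: mat_proper_def const_rat_def)
  then show ?thesis by (simp add: RL_inf_def mat_eval_const_rat)
qed

lemma mat_eval_mat_1: "\<not> mat_pole (mat 1) s" "mat_eval (mat 1) s = mat 1"
  by (simp_all add: mat_pole_def mat_eval_def mat_def vec_eq_iff rat_eval_0 rat_eval_1)

lemma mat_eval_vstack:
  assumes "\<not> mat_pole A s" "\<not> mat_pole B s"
  shows "\<not> mat_pole (vstack A B) s" "mat_eval (vstack A B) s = vstack (mat_eval A s) (mat_eval B s)"
  using assms by (auto simp: mat_pole_def mat_eval_def vstack_def vec_eq_iff split: sum.splits)

section \<open>Matrices over a ring\<close>

lemma vstack_mult: "vstack A B ** C = vstack (A ** C) (B ** C)"
  by (auto simp: vstack_def matrix_matrix_mult_def vec_eq_iff split: sum.splits)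

text \<open>
  The row and the column index types may differ, since the plant is indexed by equations on one
  side and by outputs on the other.
\<close>

lemma matrix_inv_cancel:
  fixes A :: "'a::comm_ring_1^'n^'m"
  assumes "invertible A"
  shows "A ** matrix_inv A = mat 1" "matrix_inv A ** A = mat 1"
proof -
  have "A ** matrix_inv A = mat 1 \<and> matrix_inv A ** A = mat 1"
    unfolding matrix_inv_def by (rule someI_ex) (use assms in \<open>simp add: invertible_def\<close>)
  then show "A ** matrix_inv A = mat 1" "matrix_inv A ** A = mat 1" by auto
qed

lemma matrix_inv_eqI:
  fixes A :: "'a::comm_ring_1^'n^'m"
  assumes "A ** B = mat 1" "B ** A = mat 1"
  shows "matrix_inv A = B"
proof -
  have "invertible A" using assms by (auto simp: invertible_def)
  then have l: "matrix_inv A ** A = mat 1" by (rule matrix_inv_cancel)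
  have "matrix_inv A = matrix_inv A ** (A ** B)" using assms by simp
  also have "\<dots> = B" unfolding matrix_mul_assoc l by simp
  finally show ?thesis .
qed

lemma matrix_mul_diff_rdistrib: "(A - B) ** C = A ** C - B ** C" for A :: "'a::ring_1^'n^'m"
  by (simp add: matrix_matrix_mult_def vec_eq_iff sum_subtractf left_diff_distrib)

lemma matrix_mul_add_rdistrib: "(A + B) ** C = A ** C + B ** C" for A :: "'a::semiring_1^'n^'m"
  by (simp add: matrix_matrix_mult_def vec_eq_iff sum.distrib distrib_right)

lemma matrix_uminus_mult: "(- A) ** B = - (A ** B)" for A :: "'a::ring_1^'n^'m"
  by (simp add: matrix_matrix_mult_def vec_eq_iff sum_negf)

section \<open>Spectral norms and minimal right inverses\<close>

lemma norm_le_spectral_norm: "norm (A *v x) \<le> spectral_norm A * norm x"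
  unfolding spectral_norm_def by (rule onorm) simp

lemma spectral_norm_leI:
  assumes "\<And>x. norm (A *v x) \<le> b * norm x"
  shows "spectral_norm A \<le> b"
  unfolding spectral_norm_def by (rule onorm_le) (rule assms)

lemma spectral_norm_nonneg: "spectral_norm A \<ge> 0"
  unfolding spectral_norm_def by (rule onorm_pos_le) simp

text \<open>
  The inner product on complex vectors here is the real one, the real part of the Hermitian
  product. The conjugate transpose is still the adjoint for it, so the norm estimates for right
  inverses can use the real Cauchy-Schwarz inequality.
\<close>

lemma inner_conj_transpose:
  fixes A :: "complex^'n^'m"
  shows "(conj_transpose A *v x) \<bullet> y = x \<bullet> (A *v y)"
proof -
  have Re_inner: "a \<bullet> b = Re (cnj a * b)" for a b :: complex
    by (simp add: inner_complex_def)
  have "(conj_transpose A *v x) \<bullet> y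
      = (\<Sum>i\<in>UNIV. Re (cnj (\<Sum>j\<in>UNIV. cnj (A $ j $ i) * x $ j) * y $ i))"
    by (simp only: inner_vec_def Re_inner matrix_vector_mult_def conj_transpose_def vec_lambda_beta)
  also have "\<dots> = (\<Sum>i\<in>UNIV. \<Sum>j\<in>UNIV. Re (cnj (x $ j) * (A $ j $ i * y $ i)))"
    by (simp only: cnj_sum complex_cnj_mult complex_cnj_cnj sum_distrib_right Re_sum)
      (simp only: mult_ac)
  also have "\<dots> = (\<Sum>j\<in>UNIV. \<Sum>i\<in>UNIV. Re (cnj (x $ j) * (A $ j $ i * y $ i)))"
    by (rule sum.swap)
  also have "\<dots> = x \<bullet> (A *v y)"
    by (simp only: inner_vec_def Re_inner matrix_vector_mult_def vec_lambda_beta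
        sum_distrib_left Re_sum)
  finally show ?thesis .
qed

text \<open>
  The right-hand side is the norm of a pair, so that stacked matrices can be handled in the
  product space without indexing by a sum type.
\<close>

lemma norm_vstack_mult: "norm (vstack A B *v x) = norm (A *v x, B *v x)"
  for A :: "complex^'n^'m" and B :: "complex^'n^'p"
proof -
  have "(\<Sum>i\<in>(UNIV :: ('m + 'p) set). f i) = (\<Sum>i\<in>UNIV. f (Inl i)) + (\<Sum>i\<in>UNIV. f (Inr i))"
    for f :: "'m + 'p \<Rightarrow> real"
    using sum.Plus[of "UNIV :: 'm set" "UNIV :: 'p set" f] by simp
  then have "(norm (vstack A B *v x))\<^sup>2 = (norm (A *v x))\<^sup>2 + (norm (B *v x))\<^sup>2"
    by (simp add: norm_vec_def L2_set_def sum_nonneg vstack_def matrix_vector_mult_def)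
  then have "norm (vstack A B *v x) = sqrt ((norm (A *v x))\<^sup>2 + (norm (B *v x))\<^sup>2)"
    by (metis norm_ge_zero real_sqrt_unique)
  then show ?thesis by (simp add: norm_Pair)
qed

lemma full_column_rank_ker:
  fixes A :: "'a::field^'n^'m"
  assumes "rank A = CARD('n)" and "A *v x = 0"
  shows "x = 0"
proof -
  have "vec.dim (rows A) = card (cart_basis :: ('a^'n) set)"
    using assms(1) by (simp only: row_rank_def_gen card_cart_basis)
  then have "vec.span (rows A) = UNIV"
    unfolding vec.dimension_def[symmetric] by (simp only: vec.dim_eq_full)
  then show ?thesis
    using assms(2) matrix_left_invertible_ker[of A] matrix_left_invertible_span_rows_gen[of A] by blast
qed

text \<open>
  The kernel of the Gram matrix is that of the matrix itself, because
  \<open>\<parallel>A x\<parallel>\<^sup>2\<close> is the inner product of \<open>A\<^sup>* A x\<close> and \<open>x\<close>.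
\<close>

lemma gram_invertible:
  fixes A :: "complex^'n^'m"
  assumes "rank A = CARD('n)"
  shows "invertible (conj_transpose A ** A)"
proof -
  have "x = 0" if "(conj_transpose A ** A) *v x = 0" for x
  proof -
    have "(A *v x) \<bullet> (A *v x) = (conj_transpose A *v (A *v x)) \<bullet> x"
      by (simp add: inner_conj_transpose)
    also have "\<dots> = 0" using that by (simp add: matrix_vector_mul_assoc)
    finally show "x = 0" using full_column_rank_ker[OF assms] by simp
  qed
  then show ?thesis by (meson invertible_left_inverse matrix_left_invertible_ker)
qed

text \<open>
  Let \<open>G = [M, -N]\<close>, so that \<open>P = G G\<^sup>*\<close>, let \<open>X\<close> be the right inverse with blocks \<open>Y\<close>
  and \<open>Z\<close>, and put \<open>w = P\<^sup>-\<^sup>1 v\<close>. Then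
  \<open>\<parallel>w\<parallel>\<^sup>2 = \<langle>w, G X w\<rangle> = \<langle>G\<^sup>* w, X w\<rangle> \<le> b \<parallel>G\<^sup>* w\<parallel> \<parallel>w\<parallel>\<close>, while
  \<open>\<parallel>G\<^sup>* w\<parallel>\<^sup>2 = \<langle>w, P w\<rangle> \<le> \<parallel>w\<parallel> \<parallel>v\<parallel>\<close>; cancelling \<open>\<parallel>w\<parallel>\<close> gives
  \<open>\<parallel>w\<parallel> \<le> b\<^sup>2 \<parallel>v\<parallel>\<close>.
\<close>

lemma right_inverse_norm_bound:
  fixes M :: "complex^'k^'q" and N :: "complex^'m^'q"
  defines "P \<equiv> M ** conj_transpose M + N ** conj_transpose N"
  assumes inv: "M ** Y - N ** Z = mat 1" and P: "P ** Q = mat 1"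
    and le: "\<And>x. norm (vstack Y Z *v x) \<le> b * norm x"
  shows "spectral_norm Q \<le> b\<^sup>2"
proof (rule spectral_norm_leI)
  fix v
  define w where "w = Q *v v"
  define g where "g = (conj_transpose M *v w, - (conj_transpose N *v w))"
  have Pw: "P *v w = v" by (simp add: w_def P matrix_vector_mul_assoc)
  have g2: "norm g ^ 2 = w \<bullet> v"
  proof -
    have "g \<bullet> g = w \<bullet> (M *v (conj_transpose M *v w)) + w \<bullet> (N *v (conj_transpose N *v w))"
      by (simp add: g_def inner_conj_transpose)
    also have "\<dots> = w \<bullet> (P *v w)"
      by (simp add: P_def matrix_vector_mult_add_rdistrib matrix_vector_mul_assoc inner_add_right)
    finally show ?thesis by (simp add: Pw power2_norm_eq_inner)
  qed
  have "w = M *v (Y *v w) - N *v (Z *v w)"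
    by (metis inv matrix_vector_mul_assoc matrix_vector_mul_lid matrix_vector_mult_diff_rdistrib)
  then have "norm w ^ 2 = w \<bullet> (M *v (Y *v w)) - w \<bullet> (N *v (Z *v w))"
    by (metis inner_diff_right power2_norm_eq_inner)
  also have "\<dots> = g \<bullet> (Y *v w, Z *v w)"
    by (simp add: g_def inner_conj_transpose)
  also have "\<dots> \<le> norm g * norm (Y *v w, Z *v w)" by (rule norm_cauchy_schwarz)
  also have "\<dots> \<le> norm g * (b * norm w)"
    using le[of w] by (intro mult_left_mono) (simp_all add: norm_vstack_mult)
  finally have 1: "norm w ^ 2 \<le> norm g * (b * norm w)" .
  show "norm (Q *v v) \<le> b\<^sup>2 * norm v"
  proof (cases "w = 0")
    case True
    then show ?thesis by (simp flip: w_def)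
  next
    case False
    then have w: "norm w > 0" by simp
    have "norm w \<le> b * norm g" using 1 w by (simp add: power2_eq_square mult_ac)
    then have "norm w ^ 2 \<le> (b * norm g)\<^sup>2" by (rule power_mono) simp
    also have "\<dots> = b\<^sup>2 * (w \<bullet> v)" by (simp add: power_mult_distrib g2)
    also have "\<dots> \<le> b\<^sup>2 * (norm w * norm v)" by (intro mult_left_mono norm_cauchy_schwarz) simp
    finally show ?thesis using w by (simp add: power2_eq_square flip: w_def)
  qed
qed

text \<open>
  The stacked matrix is \<open>X = G\<^sup>* P\<^sup>-\<^sup>1\<close> with \<open>G = [M, -N]\<close>, and
  \<open>X\<^sup>* X = P\<^sup>-\<^sup>1 G G\<^sup>* P\<^sup>-\<^sup>1 = P\<^sup>-\<^sup>1\<close>.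
\<close>

lemma pseudo_inverse_norm:
  fixes M :: "complex^'k^'q" and N :: "complex^'m^'q"
  defines "P \<equiv> M ** conj_transpose M + N ** conj_transpose N"
  assumes P: "P ** Q = mat 1"
  shows "spectral_norm (vstack (conj_transpose M ** Q) (- (conj_transpose N ** Q))) \<le>
    sqrt (spectral_norm Q)"
proof (rule spectral_norm_leI)
  fix v
  define w where "w = Q *v v"
  have Pw: "P *v w = v" by (simp add: w_def P matrix_vector_mul_assoc)
  have neg: "(- A) *v v = - (A *v v)" for A :: "complex^'q^'m"
    by (metis matrix_vector_mult_0 matrix_vector_mult_diff_rdistrib diff_0)
  let ?X = "vstack (conj_transpose M ** Q) (- (conj_transpose N ** Q))"
  have "norm (?X *v v) ^ 2 = norm (conj_transpose M *v w, - (conj_transpose N *v w)) ^ 2"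
    by (simp add: norm_vstack_mult w_def neg matrix_vector_mul_assoc)
  also have "\<dots> = w \<bullet> (M *v (conj_transpose M *v w)) + w \<bullet> (N *v (conj_transpose N *v w))"
    by (simp add: power2_norm_eq_inner inner_conj_transpose)
  also have "\<dots> = w \<bullet> (P *v w)"
    by (simp add: P_def matrix_vector_mult_add_rdistrib matrix_vector_mul_assoc inner_add_right)
  also have "\<dots> \<le> norm w * norm v" unfolding Pw by (rule norm_cauchy_schwarz)
  also have "\<dots> \<le> spectral_norm Q * norm v * norm v"
    unfolding w_def by (intro mult_right_mono norm_le_spectral_norm) simp
  also have "\<dots> = (sqrt (spectral_norm Q) * norm v)\<^sup>2"
    by (simp add: power_mult_distrib spectral_norm_nonneg power2_eq_square[of "norm v"])
  finally show "norm (?X *v v) \<le> sqrt (spectral_norm Q) * norm v"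
    by (rule power2_le_imp_le) (simp add: spectral_norm_nonneg)
qed

text \<open>
  With \<open>H = (M\<^sup>* M)\<^sup>-\<^sup>1\<close> the gain is \<open>K = - N\<^sup>* M H\<close>, and \<open>M = M (M\<^sup>* M) H\<close> yields the
  factorization \<open>M - N K = P M H\<close>. Hence \<open>M H D = P\<^sup>-\<^sup>1\<close>, and multiplying by \<open>M\<^sup>*\<close> or
  \<open>- N\<^sup>*\<close> from the left gives the two blocks of the pseudo-inverse of \<open>[M, -N]\<close>.
\<close>

lemma least_squares_gain_inverse:
  fixes M :: "complex^'k^'q" and N :: "complex^'m^'q"
  defines "P \<equiv> M ** conj_transpose M + N ** conj_transpose N"
  assumes K: "K = - (conj_transpose N ** M ** matrix_inv (conj_transpose M ** M))"
    and gram: "invertible (conj_transpose M ** M)" and P: "invertible P"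
    and D: "(M - N ** K) ** D = mat 1"
  shows "D = conj_transpose M ** matrix_inv P" "K ** D = - (conj_transpose N ** matrix_inv P)"
proof -
  define H where "H = matrix_inv (conj_transpose M ** M)"
  have H: "conj_transpose M ** M ** H = mat 1" using gram by (simp add: H_def matrix_inv_cancel)
  have "N ** K + N ** (conj_transpose N ** M ** H) = N ** (K + conj_transpose N ** M ** H)"
    by (simp add: matrix_add_ldistrib)
  also have "\<dots> = 0" by (simp add: K H_def)
  finally have NK: "N ** K = - (N ** (conj_transpose N ** M ** H))"
    by (simp add: eq_neg_iff_add_eq_0)
  have "P ** (M ** H) = M ** (conj_transpose M ** M ** H) + N ** (conj_transpose N ** M ** H)"
    by (simp add: P_def matrix_mul_add_rdistrib matrix_mul_assoc)
  also have "\<dots> = M - N ** K" by (simp add: H NK)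
  finally have "P ** (M ** H ** D) = mat 1" using D by (simp add: matrix_mul_assoc)
  then have "matrix_inv P ** (P ** (M ** H ** D)) = matrix_inv P" by simp
  then have MHD: "M ** H ** D = matrix_inv P"
    using P by (simp add: matrix_mul_assoc matrix_inv_cancel)
  have "conj_transpose M ** matrix_inv P = (conj_transpose M ** M ** H) ** D"
    by (simp add: matrix_mul_assoc flip: MHD)
  then show "D = conj_transpose M ** matrix_inv P" by (simp add: H)
  show "K ** D = - (conj_transpose N ** matrix_inv P)"
    by (simp add: K matrix_uminus_mult matrix_mul_assoc flip: MHD H_def)
qed

section \<open>Rational matrices on the right half plane\<close>

lemma rat_eval_field_differentiable:
  assumes "\<not> rat_pole f s"
  shows "rat_eval f field_differentiable at s"
proof -
  have "(\<lambda>s. cpoly (fst (quot_of_fract f)) s / cpoly (snd (quot_of_fract f)) s) field_differentiable at s"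
    using assms unfolding rat_pole_def
    by (intro field_differentiable_divide) 
      (auto simp: field_differentiable_def intro: poly_DERIV)
  then show ?thesis by (simp add: rat_eval_def[abs_def])
qed

lemma rat_eval_tendsto_at_infinity:
  assumes "rat_proper f"
  shows "\<exists>l. (rat_eval f \<longlongrightarrow> l) at_infinity"
proof -
  define p q where "p = map_poly (of_real :: real \<Rightarrow> complex) (fst (quot_of_fract f))"
    and "q = map_poly (of_real :: real \<Rightarrow> complex) (snd (quot_of_fract f))"
  have eq: "rat_eval f = (\<lambda>s. poly p s / poly q s)"
    by (simp add: rat_eval_def[abs_def] p_def q_def)
  have d: "degree p \<le> degree q"
    using assms by (simp add: rat_proper_def p_def q_def degree_cpoly)
  show ?thesis
  proof (cases "degree p < degree q")
    case True
    then show ?thesis unfolding eq using poly_divide_tendsto_0_at_infinity by blast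
  next
    case False
    then have eqd: "degree p = degree q" using d by simp
    have "q \<noteq> 0" by (simp add: q_def map_poly_eq_0_iff)
    then have "((\<lambda>s. (poly p s / s ^ degree p) / (poly q s / s ^ degree q))
        \<longlongrightarrow> lead_coeff p / lead_coeff q) at_infinity"
      by (intro tendsto_divide poly_divide_tendsto_aux) simp
    moreover have "eventually (\<lambda>s. (poly p s / s ^ degree p) / (poly q s / s ^ degree q)
        = poly p s / poly q s) at_infinity"
      using eventually_not_equal_at_infinity[of 0] by eventually_elim (simp add: eqd)
    ultimately have "((\<lambda>s. poly p s / poly q s) \<longlongrightarrow> lead_coeff p / lead_coeff q) at_infinity"
      by (rule Lim_transform_eventually)
    then show ?thesis unfolding eq by (rule exI)
  qed
qed

text \<open>
  The half plane is unbounded, so the maximum modulus principle is applied to large half discs.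
  On the circular arc the function is close to its limit at infinity, and this limit obeys the
  bound because it is also the limit along the imaginary axis.
\<close>

lemma half_plane_maximum_modulus:
  assumes diff: "\<And>s. Re s \<ge> 0 \<Longrightarrow> f field_differentiable at s"
    and lim: "(f \<longlongrightarrow> l) at_infinity"
    and le: "\<And>\<omega>::real. norm (f (\<i> * of_real \<omega>)) \<le> C"
    and z: "Re z > 0"
  shows "norm (f z) \<le> C"
proof -
  have "filterlim (\<lambda>\<omega>::real. \<i> * of_real \<omega>) at_infinity at_top"
    by (intro filterlim_norm_at_top_imp_at_infinity) (simp add: norm_mult filterlim_abs_real)
  then have "((\<lambda>\<omega>::real. f (\<i> * of_real \<omega>)) \<longlongrightarrow> l) at_top"
    using lim by (rule filterlim_compose[rotated])
  then have l: "norm l \<le> C"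
    by (intro tendsto_upperbound[OF tendsto_norm]) (auto simp: le)
  show ?thesis
  proof (rule field_le_epsilon)
    fix e :: real assume e: "e > 0"
    have "eventually (\<lambda>s. dist (f s) l < e) at_infinity"
      using lim e by (rule tendstoD)
    then obtain R where R: "\<And>s. norm s \<ge> R \<Longrightarrow> dist (f s) l < e"
      by (auto simp: eventually_at_infinity)
    have far: "norm (f s) \<le> C + e" if "norm s \<ge> R" for s
      using R[OF that] l norm_triangle_ineq2[of "f s" l] by (simp add: dist_norm)
    \<comment> \<open>Beyond \<open>R\<close> the limit gives the bound; the second entry puts \<open>z\<close> inside the half disc.\<close>
    define r where "r = max R (norm z + 1)"
    define S where "S = {s. Re s > 0} \<inter> ball 0 r"
    have cl: "closure S \<subseteq> {s. Re s \<ge> 0} \<inter> cball 0 r"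
      by (rule closure_minimal) (auto simp: S_def intro!: closed_Int closed_halfspace_Re_ge)
    have op: "open S" by (auto simp: S_def intro!: open_Int open_halfspace_Re_gt)
    show "norm (f z) \<le> C + e"
    proof (rule maximum_modulus_frontier[where f = f and S = S])
      show "f holomorphic_on interior S"
        unfolding holomorphic_on_def interior_open[OF op]
      proof
        fix s assume "s \<in> S"
        then have "Re s \<ge> 0" by (simp add: S_def)
        then show "f field_differentiable at s within S"
          by (rule field_differentiable_at_within[OF diff])
      qed
      show "continuous_on (closure S) f"
      proof (intro continuous_at_imp_continuous_on ballI)
        fix s assume "s \<in> closure S"
        then have "Re s \<ge> 0" using cl by blast
        then show "isCont f s" by (rule field_differentiable_imp_continuous_at[OF diff])
      qed
      show "bounded S" by (simp add: S_def bounded_Int)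
      show "z \<in> S" using z by (auto simp: S_def r_def)
      fix s assume s: "s \<in> frontier S"
      then have s': "s \<in> closure S" "s \<notin> S" using op by (auto simp: frontier_def interior_open)
      show "norm (f s) \<le> C + e"
      proof (cases "norm s \<ge> r")
        case True
        then show ?thesis by (intro far) (simp add: r_def)
      next
        case False
        then have "Re s = 0" using s' cl by (auto simp: S_def)
        then have "s = \<i> * of_real (Im s)" by (simp add: complex_eq_iff)
        then show ?thesis using le[of "Im s"] e by simp
      qed
    qed
  qed
qed

lemma norm_sum_cnj_le: "norm (\<Sum>i\<in>UNIV. cnj (y $ i) * x $ i) \<le> norm y * norm x"
  for x y :: "complex^'n"
proof -
  have "norm (\<Sum>i\<in>UNIV. cnj (y $ i) * x $ i) \<le> (\<Sum>i\<in>UNIV. \<bar>norm (y $ i)\<bar> * \<bar>norm (x $ i)\<bar>)"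
    by (rule order_trans[OF norm_sum]) (simp add: norm_mult)
  also have "\<dots> \<le> norm y * norm x"
    unfolding norm_vec_def by (rule L2_set_mult_ineq)
  finally show ?thesis .
qed

text \<open>
  To reduce the matrix statement to the scalar maximum principle, fix \<open>s\<close> and \<open>v\<close> and pair
  \<open>F z = C D(z) v\<close> with the constant vector \<open>F s\<close>. The pairing is holomorphic in \<open>z\<close>, is at
  most \<open>\<parallel>F s\<parallel> \<parallel>F z\<parallel>\<close> everywhere, and equals \<open>\<parallel>F s\<parallel>\<^sup>2\<close> at \<open>z = s\<close>. The constant
  factor \<open>C\<close> accommodates the stacked matrix of identity and gain.
\<close>

lemma spectral_norm_half_plane_le:
  fixes C :: "complex^'p^'m" and D :: "ratfun^'n^'p"
  assumes D: "D \<in> RH_inf"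
    and le: "\<And>\<omega>::real. spectral_norm (C ** mat_eval D (\<i> * of_real \<omega>)) \<le> b"
    and s: "Re s > 0"
  shows "spectral_norm (C ** mat_eval D s) \<le> b"
proof (rule spectral_norm_leI)
  fix v
  define F where "F = (\<lambda>z. (C ** mat_eval D z) *v v)"
  define g where "g = (\<lambda>z. \<Sum>i\<in>UNIV. cnj (F s $ i) * F z $ i)"
  have F: "F z $ i = (\<Sum>k\<in>UNIV. C $ i $ k * (\<Sum>j\<in>UNIV. rat_eval (D $ k $ j) z * v $ j))" for z i
    unfolding F_def matrix_vector_mul_assoc[symmetric]
    by (simp only: matrix_vector_mult_def mat_eval_def vec_lambda_beta)
  have "\<exists>l. (rat_eval (D $ k $ j) \<longlongrightarrow> l) at_infinity" for k j
    using D by (intro rat_eval_tendsto_at_infinity) (simp add: RH_inf_def mat_proper_def)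
  then obtain l where l: "\<And>k j. (rat_eval (D $ k $ j) \<longlongrightarrow> l k j) at_infinity"
    by metis
  have "norm (g s) \<le> norm (F s) * (b * norm v)"
  proof (rule half_plane_maximum_modulus[where f = g])
    fix z :: complex assume "Re z \<ge> 0"
    then have "\<not> rat_pole (D $ k $ j) z" for k j
      using D by (force simp: RH_inf_def mat_pole_def)
    then show "g field_differentiable at z"
      unfolding g_def F
      by (intro field_differentiable_sum field_differentiable_mult field_differentiable_const
          rat_eval_field_differentiable)
  next
    show "(g \<longlongrightarrow> (\<Sum>i\<in>UNIV. cnj (F s $ i) * (\<Sum>k\<in>UNIV. C $ i $ k * (\<Sum>j\<in>UNIV. l k j * v $ j)))) at_infinity"
      unfolding g_def F by (intro tendsto_sum tendsto_mult tendsto_const l)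
  next
    fix \<omega> :: real
    have "norm (F (\<i> * of_real \<omega>)) \<le> b * norm v"
      unfolding F_def by (rule order_trans[OF norm_le_spectral_norm mult_right_mono[OF le]]) simp
    then have "norm (F s) * norm (F (\<i> * of_real \<omega>)) \<le> norm (F s) * (b * norm v)"
      by (rule mult_left_mono) simp
    then show "norm (g (\<i> * of_real \<omega>)) \<le> norm (F s) * (b * norm v)"
      unfolding g_def using norm_sum_cnj_le order_trans by blast
  qed (rule s)
  moreover have "g s = of_real ((norm (F s))\<^sup>2)"
  proof -
    have "(norm (F s))\<^sup>2 = (\<Sum>i\<in>UNIV. (norm (F s $ i))\<^sup>2)"
      by (simp add: norm_vec_def L2_set_def sum_nonneg)
    then show ?thesis
      by (simp only: g_def of_real_sum complex_norm_square mult.commute)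
  qed
  ultimately have "norm (F s) * norm (F s) \<le> norm (F s) * (b * norm v)"
    by (simp add: norm_power power2_eq_square del: of_real_power of_real_mult)
  moreover have "0 \<le> b * norm v"
    using le[of 0] spectral_norm_nonneg[of "C ** mat_eval D (\<i> * of_real 0)"] by simp
  ultimately show "norm ((C ** mat_eval D s) *v v) \<le> b * norm v"
    unfolding F_def[symmetric]
    by (cases "F s = 0") (simp_all add: F_def)
qed

text \<open>
  The norm is a supremum over the open half plane, so a point of the imaginary axis has to be
  approached from the right. \<open>F\<close> may have poles elsewhere in the right half plane; only its
  behaviour near the point matters.
\<close>

lemma spectral_norm_imag_axis_le_Hinf_norm:
  fixes \<omega> :: real
  assumes "\<not> mat_pole F (\<i> * of_real \<omega>)"
  shows "ereal (spectral_norm (mat_eval F (\<i> * of_real \<omega>))) \<le> Hinf_norm F"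
proof -
  have up: "ereal (spectral_norm (mat_eval F s)) \<le> Hinf_norm F" if "Re s > 0" for s
    unfolding Hinf_norm_def using that by (intro SUP_upper) simp
  show ?thesis
  proof (cases "Hinf_norm F")
    case (real r)
    define s where "s = (\<lambda>n. \<i> * of_real \<omega> + of_real (inverse (real (Suc n))))"
    have "s \<longlonglongrightarrow> \<i> * of_real \<omega> + of_real 0"
      unfolding s_def by (intro tendsto_intros LIMSEQ_inverse_real_of_nat)
    then have s: "s \<longlonglongrightarrow> \<i> * of_real \<omega>" by simp
    have lim: "(\<lambda>n. mat_eval F (s n) *v v) \<longlonglongrightarrow> mat_eval F (\<i> * of_real \<omega>) *v v" for v
    proof (rule vec_tendstoI)
      fix i
      have "isCont (rat_eval (F $ i $ j)) (\<i> * of_real \<omega>)" for j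
        using assms by (intro field_differentiable_imp_continuous_at rat_eval_field_differentiable)
          (auto simp: mat_pole_def)
      then have "(\<lambda>n. rat_eval (F $ i $ j) (s n)) \<longlonglongrightarrow> rat_eval (F $ i $ j) (\<i> * of_real \<omega>)" for j
        using s by (rule isCont_tendsto_compose)
      then show "(\<lambda>n. (mat_eval F (s n) *v v) $ i) \<longlonglongrightarrow> (mat_eval F (\<i> * of_real \<omega>) *v v) $ i"
        unfolding matrix_vector_mult_def mat_eval_def vec_lambda_beta
        by (intro tendsto_sum tendsto_mult tendsto_const)
    qed
    have "spectral_norm (mat_eval F (\<i> * of_real \<omega>)) \<le> r"
    proof (rule spectral_norm_leI)
      fix v
      have "norm (mat_eval F (s n) *v v) \<le> r * norm v" for n
      proof -
        have "spectral_norm (mat_eval F (s n)) \<le> r"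
          using up[of "s n"] by (simp add: real s_def)
        then show ?thesis
          by (rule order_trans[OF norm_le_spectral_norm mult_right_mono]) simp
      qed
      then show "norm (mat_eval F (\<i> * of_real \<omega>) *v v) \<le> r * norm v"
        by (intro LIMSEQ_le_const2[OF tendsto_norm[OF lim]] exI allI impI)
    qed
    then show ?thesis by (simp add: real)
  next
    case MInf
    then show ?thesis using up[of 1] by simp
  qed simp
qed

section \<open>The optimal control problem\<close>

lemma closed_loop_eq_vstack:
  "closed_loop M N K = vstack (matrix_inv (M - N ** K)) (K ** matrix_inv (M - N ** K))"
  by (simp add: closed_loop_def vstack_mult)

text \<open>
  One frequency suffices for a lower bound: there every stabilizing controller provides a right
  inverse of the same matrix.
\<close>

lemma optimal_value_ge:
  fixes M :: "ratfun^'k^'q" and N :: "ratfun^'m^'q" and \<omega> :: real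
  defines "M\<^sub>0 \<equiv> mat_eval M (\<i> * of_real \<omega>)" and "N\<^sub>0 \<equiv> mat_eval N (\<i> * of_real \<omega>)"
  assumes M: "\<not> mat_pole M (\<i> * of_real \<omega>)" and N: "\<not> mat_pole N (\<i> * of_real \<omega>)"
    and Q: "(M\<^sub>0 ** conj_transpose M\<^sub>0 + N\<^sub>0 ** conj_transpose N\<^sub>0) ** Q = mat 1"
  shows "ereal (sqrt (spectral_norm Q)) \<le> optimal_value M N"
  unfolding optimal_value_def
proof (rule INF_greatest)
  fix K assume K: "K \<in> stabilizing M N"
  define D where "D = matrix_inv (M - N ** K)"
  let ?s = "\<i> * of_real \<omega> :: complex"
  have pK: "\<not> mat_pole K ?s" and pD: "\<not> mat_pole D ?s"
    using K by (force simp: stabilizing_def RL_inf_def RH_inf_def D_def)+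
  note pNK = mat_eval_mult[OF N pK] and pKD = mat_eval_mult[OF pK pD]
  note pA = mat_eval_diff[OF M pNK(1)] and eX = mat_eval_vstack[OF pD pKD(1)]
  define X where "X = vstack (mat_eval D ?s) (mat_eval K ?s ** mat_eval D ?s)"
  have "(M - N ** K) ** D = mat 1"
    using K by (simp add: stabilizing_def D_def matrix_inv_cancel)
  then have "(M\<^sub>0 - N\<^sub>0 ** mat_eval K ?s) ** mat_eval D ?s = mat 1"
    using mat_eval_mult(2)[OF pA(1) pD] by (simp add: pA(2) pNK(2) mat_eval_mat_1 M\<^sub>0_def N\<^sub>0_def)
  then have "M\<^sub>0 ** mat_eval D ?s - N\<^sub>0 ** (mat_eval K ?s ** mat_eval D ?s) = mat 1"
    by (simp add: matrix_mul_diff_rdistrib matrix_mul_assoc)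
  then have "spectral_norm Q \<le> (spectral_norm X)\<^sup>2"
    unfolding X_def by (rule right_inverse_norm_bound[OF _ Q]) (rule norm_le_spectral_norm)
  then have "sqrt (spectral_norm Q) \<le> spectral_norm X"
    by (simp add: real_le_lsqrt spectral_norm_nonneg)
  also have "ereal (spectral_norm X) \<le> Hinf_norm (closed_loop M N K)"
    using spectral_norm_imag_axis_le_Hinf_norm[OF eX(1)]
    unfolding eX(2) pKD(2) X_def closed_loop_eq_vstack D_def[symmetric] .
  finally show "ereal (sqrt (spectral_norm Q)) \<le> Hinf_norm (closed_loop M N K)" by simp
qed

theorem theorem1:
  fixes M :: "ratfun^'k::finite^'q::finite"
    and N :: "ratfun^'m::finite^'q"
    and K :: "real^'k^'m"
    and \<omega>\<^sub>0 :: real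
  defines "Mj \<equiv> \<lambda>\<omega>::real. mat_eval M (\<i> * complex_of_real \<omega>)"
    and "Nj \<equiv> \<lambda>\<omega>::real. mat_eval N (\<i> * complex_of_real \<omega>)"
  assumes "causal_well_posed M N"
    and "\<And>\<omega>::real. \<not> mat_pole M (\<i> * complex_of_real \<omega>)"
    and "\<And>\<omega>::real. \<not> mat_pole N (\<i> * complex_of_real \<omega>)"
    and "\<And>\<omega>. rank (Mj \<omega>) = CARD('k)"
    and "\<And>\<omega>. invertible
           (Mj \<omega> ** conj_transpose (Mj \<omega>) + Nj \<omega> ** conj_transpose (Nj \<omega>))"
    and "cmat K = - (conj_transpose (Nj \<omega>\<^sub>0) ** Mj \<omega>\<^sub>0 **
                     matrix_inv (conj_transpose (Mj \<omega>\<^sub>0) ** Mj \<omega>\<^sub>0))"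
    and "invertible (M - N ** const_rat K)"
    and "matrix_inv (M - N ** const_rat K) \<in> RH_inf"
    and "is_arg_max
           (\<lambda>\<omega>. spectral_norm
              (vstack (mat 1) (cmat K) ** matrix_inv (Mj \<omega> - Nj \<omega> ** cmat K)))
           (\<lambda>\<omega>. \<omega> \<in> UNIV) \<omega>\<^sub>0"
  shows "solves_Hinf M N (const_rat K) \<and>
         optimal_value M N =
           ereal (sqrt (spectral_norm (matrix_inv
             (Mj \<omega>\<^sub>0 ** conj_transpose (Mj \<omega>\<^sub>0) + Nj \<omega>\<^sub>0 ** conj_transpose (Nj \<omega>\<^sub>0)))))"
proof -
  define Q where "Q = matrix_inv
    (Mj \<omega>\<^sub>0 ** conj_transpose (Mj \<omega>\<^sub>0) + Nj \<omega>\<^sub>0 ** conj_transpose (Nj \<omega>\<^sub>0))"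
  define D where "D = matrix_inv (M - N ** const_rat K)"
  let ?b = "sqrt (spectral_norm Q)"
  let ?C = "vstack (mat 1) (cmat K)"
  have Q: "(Mj \<omega>\<^sub>0 ** conj_transpose (Mj \<omega>\<^sub>0) + Nj \<omega>\<^sub>0 ** conj_transpose (Nj \<omega>\<^sub>0)) ** Q = mat 1"
    unfolding Q_def by (rule matrix_inv_cancel(1)[OF assms(7)])
  have D: "D \<in> RH_inf" using assms(10) by (simp add: D_def)
  have pD: "\<not> mat_pole D s" if "Re s \<ge> 0" for s
    using D that by (force simp: RH_inf_def)
  have AD: "(Mj \<omega> - Nj \<omega> ** cmat K) ** mat_eval D (\<i> * of_real \<omega>) = mat 1"
    and DA: "mat_eval D (\<i> * of_real \<omega>) ** (Mj \<omega> - Nj \<omega> ** cmat K) = mat 1" for \<omega> :: real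
  proof -
    let ?s = "\<i> * of_real \<omega> :: complex"
    note NK = mat_eval_mult[OF assms(5)[of \<omega>] mat_eval_const_rat(1)[of K]]
    note A = mat_eval_diff[OF assms(4) NK(1)]
    have d: "\<not> mat_pole D ?s" by (rule pD) simp
    have eq: "mat_eval (M - N ** const_rat K) ?s = Mj \<omega> - Nj \<omega> ** cmat K"
      by (simp add: A(2) NK(2) mat_eval_const_rat Mj_def Nj_def)
    show "(Mj \<omega> - Nj \<omega> ** cmat K) ** mat_eval D ?s = mat 1"
      using mat_eval_mult(2)[OF A(1) d]
      by (simp add: eq D_def matrix_inv_cancel[OF assms(9)] mat_eval_mat_1)
    show "mat_eval D ?s ** (Mj \<omega> - Nj \<omega> ** cmat K) = mat 1"
      using mat_eval_mult(2)[OF d A(1)]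
      by (simp add: eq D_def matrix_inv_cancel[OF assms(9)] mat_eval_mat_1)
  qed
  \<comment> \<open>So the inverse of the value is the value of the inverse, which links the maximized function
    to the closed-loop map.\<close>
  have inv: "matrix_inv (Mj \<omega> - Nj \<omega> ** cmat K) = mat_eval D (\<i> * of_real \<omega>)" for \<omega> :: real
    by (rule matrix_inv_eqI[OF AD DA])
  note opt = least_squares_gain_inverse[OF assms(8) gram_invertible[OF assms(6)] assms(7) AD,
      folded Q_def]
  \<comment> \<open>The block with the gain is rewritten first: its equation mentions \<open>D\<close>, which the other
    equation replaces.\<close>
  have "spectral_norm (?C ** mat_eval D (\<i> * of_real \<omega>\<^sub>0)) \<le> ?b"
    using pseudo_inverse_norm[OF Q]
    by (simp add: vstack_mult opt(2)) (simp add: opt(1))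
  moreover have "spectral_norm (?C ** mat_eval D (\<i> * of_real \<omega>)) \<le>
      spectral_norm (?C ** mat_eval D (\<i> * of_real \<omega>\<^sub>0))" for \<omega> :: real
    using assms(11) by (simp add: is_arg_max_def inv not_less)
  ultimately have imag: "spectral_norm (?C ** mat_eval D (\<i> * of_real \<omega>)) \<le> ?b" for \<omega> :: real
    using order_trans by blast
  have ev: "mat_eval (closed_loop M N (const_rat K)) s = ?C ** mat_eval D s" if "Re s > 0" for s
  proof -
    have d: "\<not> mat_pole D s" by (rule pD) (use that in simp)
    have KD: "\<not> mat_pole (const_rat K ** D) s"
      "mat_eval (const_rat K ** D) s = cmat K ** mat_eval D s"
      using mat_eval_mult[OF mat_eval_const_rat(1) d, of K] by (simp_all add: mat_eval_const_rat(2))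
    show ?thesis
      using mat_eval_vstack(2)[OF d KD(1)]
      by (simp add: KD(2) closed_loop_eq_vstack vstack_mult flip: D_def)
  qed
  have upper: "Hinf_norm (closed_loop M N (const_rat K)) \<le> ereal ?b"
    unfolding Hinf_norm_def
    by (intro SUP_least) (simp add: ev spectral_norm_half_plane_le[OF D imag])
  have lower: "ereal ?b \<le> optimal_value M N"
    using assms(4,5) Q unfolding Mj_def Nj_def by (rule optimal_value_ge)
  have stab: "const_rat K \<in> stabilizing M N"
    using assms(9,10) by (simp add: stabilizing_def const_rat_in_RL_inf)
  then have "optimal_value M N \<le> Hinf_norm (closed_loop M N (const_rat K))"
    unfolding optimal_value_def by (rule INF_lower)
  then have "Hinf_norm (closed_loop M N (const_rat K)) = optimal_value M N"
    "optimal_value M N = ereal ?b"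
    using upper lower by auto
  then show ?thesis using stab by (simp add: solves_Hinf_def Q_def)
qed

end
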